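(* For every finite $2$-flat metric space $X$, $\lim_{t\to+\infty}\tau_2(tX)=0$.
   Context: For $z\in\mathbb{R}^2$, let $\|z\|_{\mathbb{Z}}=\operatorname{dist}(z,\mathbb{Z}^2)$ denote the Euclidean distance from $z$ to the standard lattice $\mathbb{Z}^2\subset\mathbb{R}^2$. For a finite metric space $X=(X,d)$, let $\Sigma_2(X)$ be the collection of isometric (i.e. distance-preserving) embeddings $f\colon X\to\mathbb{R}^2$, where $\mathbb{R}^2$ carries the Euclidean metric, and set $\tau_2(X)=\inf_{f\in\Sigma_2(X)}\big(\max_{x\in X}\|f(x)\|_{\mathbb{Z}}\big)$, with $\tau_2(X)=\infty$ if $\Sigma_2(X)=\emptyset$. A metric space $X$ is called $2$-flat if it embeds isometrically into $\mathbb{R}^2$, i.e. $\Sigma_2(X)\neq\emptyset$. For $t>0$, $tX$ denotes the metric space $(X,td)$. *)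

theory Defs
  imports "HOL-Analysis.Analysis"
begin

definition int_lattice :: "(real ^ 2) set" where
  "int_lattice = {z. \<forall>i. z $ i \<in> \<int>}"

definition norm_Z :: "real ^ 2 \<Rightarrow> real" where
  "norm_Z z = infdist z int_lattice"

(* A metric space is given by a carrier X and a distance d.  Extensionality makes the
   members of Sigma2 correspond one-to-one to the maps with domain X. *)
definition Sigma2 :: "'a set \<Rightarrow> ('a \<Rightarrow> 'a \<Rightarrow> real) \<Rightarrow> ('a \<Rightarrow> real ^ 2) set" where
  "Sigma2 X d = {f \<in> extensional X. \<forall>x\<in>X. \<forall>y\<in>X. dist (f x) (f y) = d x y}"

(* Values in ennreal, so that the infimum over an empty Sigma2 is infinity.  The inner
   supremum is the maximum when X is finite and nonempty (SUP_norm_Z_eq_Max), and 0 when X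
   is empty. *)
definition tau2 :: "'a set \<Rightarrow> ('a \<Rightarrow> 'a \<Rightarrow> real) \<Rightarrow> ennreal" where
  "tau2 X d = (INF f\<in>Sigma2 X d. SUP x\<in>X. ennreal (norm_Z (f x)))"

definition two_flat :: "'a set \<Rightarrow> ('a \<Rightarrow> 'a \<Rightarrow> real) \<Rightarrow> bool" where
  "two_flat X d \<longleftrightarrow> Sigma2 X d \<noteq> {}"

definition scale_dist :: "real \<Rightarrow> ('a \<Rightarrow> 'a \<Rightarrow> real) \<Rightarrow> 'a \<Rightarrow> 'a \<Rightarrow> real" where
  "scale_dist t d = (\<lambda>x y. t * d x y)"

lemma SUP_norm_Z_eq_Max:
  assumes "finite X" "X \<noteq> {}"
  shows "(SUP x\<in>X. ennreal (norm_Z (f x))) = ennreal (MAX x\<in>X. norm_Z (f x))"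
proof -
  have "mono ennreal" by (auto intro: monoI ennreal_leI)
  then have "ennreal (MAX x\<in>X. norm_Z (f x)) = Max (ennreal ` (\<lambda>x. norm_Z (f x)) ` X)"
    using assms by (intro mono_Max_commute) auto
  also have "\<dots> = (SUP x\<in>X. ennreal (norm_Z (f x)))"
    using assms by (simp add: Max_Sup image_image)
  finally show ?thesis by simp
qed

lemma tau2_not_flat: "\<not> two_flat X d \<Longrightarrow> tau2 X d = \<infinity>"
  by (simp add: two_flat_def tau2_def)

lemma Metric_space_scale_dist:
  assumes "Metric_space X d" "t > 0"
  shows "Metric_space X (scale_dist t d)"
proof -
  interpret Metric_space X d by fact
  show ?thesis
    using assms(2) triangle
    by unfold_locales
      (auto simp: scale_dist_def commute distrib_left[symmetric] simp del: distrib_left_numeral)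
qed

end

theory Submission
  imports Defs
begin

text \<open>
  Identify the plane with \<open>\<complex>\<close> and \<open>\<int>\<^sup>2\<close> with the Gaussian integers, and fix a copy
  of \<open>X\<close> in \<open>\<complex>\<close>. Multiplying it by a complex number \<open>z\<close> of modulus \<open>t\<close> gives a copy of
  \<open>tX\<close>, so it suffices to find, for every large \<open>t\<close>, a point \<open>z\<close> of the circle of radius
  \<open>t\<close> such that \<open>Re z\<close> and \<open>Im z\<close> times any coordinate \<open>x\<close> of the copy are close to
  integers.

  A large circle is locally almost a straight line: near the point where its tangent has
  direction \<open>w\<close>, a segment of fixed length differs from the circle by \<open>O(1/t)\<close>. It therefore
  suffices to find one direction \<open>w\<close> and one bound \<open>L\<close> such that, for every starting point
  \<open>z\<close>, some point \<open>z + kw\<close> with \<open>\<bar>k\<bar> \<le> L\<close> is good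
  (\<open>line_meets_near_lattice\<close>). The uniformity in the starting point is essential, because the
  tangent point moves with \<open>t\<close>; \<open>circle_meets_near_lattice\<close> then bends the segment.

  Such a \<open>w\<close> is found arithmetically. The finitely many coordinates are integer combinations
  of finitely many reals \<open>B\<close> that are linearly independent over \<open>\<int>\<close>
  (\<open>int_independent_generators_exist\<close>), so only the elements of \<open>B\<close> have to be made almost
  integral. All but countably many slopes \<open>r\<close> keep \<open>B \<union> rB\<close> independent
  (\<open>generic_slope_exists\<close>). For \<open>w = 1 + ir\<close>, moving by \<open>kw\<close> changes \<open>b Re z\<close> by \<open>kb\<close> and
  \<open>b Im z\<close> by \<open>krb\<close>, and by Kronecker's theorem these can be steered simultaneously to any
  prescribed residues modulo 1. Since the torus of residues is compact, a bounded time \<open>k\<close>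
  suffices (\<open>kronecker_bounded_time\<close>).
\<close>

section \<open>Linear independence over the integers\<close>

text \<open>
  Only meaningful for finite \<open>B\<close>, since sums over infinite sets are 0. The coefficients are
  indexed by the reals themselves, which avoids an enumeration of \<open>B\<close>.
\<close>
definition int_independent :: "real set \<Rightarrow> bool" where
  "int_independent B \<longleftrightarrow> (\<forall>u::real \<Rightarrow> int. (\<Sum>b\<in>B. of_int (u b) * b) = 0 \<longrightarrow> (\<forall>b\<in>B. u b = 0))"

definition int_span :: "real set \<Rightarrow> real set" where
  "int_span B = (\<lambda>u::real \<Rightarrow> int. \<Sum>b\<in>B. of_int (u b) * b) ` UNIV"

lemma int_span_rescale:
  assumes "m \<noteq> (0::int)" "x \<in> int_span B"
  shows "x \<in> int_span ((\<lambda>b. b / of_int m) ` B)"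
proof -
  from assms(2) obtain u :: "real \<Rightarrow> int" where u: "x = (\<Sum>b\<in>B. of_int (u b) * b)"
    unfolding int_span_def by auto
  have inj: "inj_on (\<lambda>b::real. b / of_int m) B"
    using assms(1) by (auto simp: inj_on_def)
  have "x = (\<Sum>b\<in>(\<lambda>b. b / of_int m) ` B. of_int (u (b * of_int m) * m) * b)"
    unfolding u using assms(1) by (subst sum.reindex[OF inj]) (auto intro!: sum.cong)
  then show ?thesis unfolding int_span_def by (intro image_eqI[where x = "\<lambda>b. u (b * of_int m) * m"]) auto
qed

lemma int_independent_rescale:
  assumes "m \<noteq> (0::real)" "int_independent B"
  shows "int_independent ((\<lambda>b. b / m) ` B)"
  unfolding int_independent_def
proof (intro allI impI)
  fix u :: "real \<Rightarrow> int"
  assume *: "(\<Sum>b\<in>(\<lambda>b. b / m) ` B. of_int (u b) * b) = 0"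
  have inj: "inj_on (\<lambda>b::real. b / m) B"
    using assms(1) by (auto simp: inj_on_def)
  have "(\<Sum>b\<in>B. of_int (u (b / m)) * b) / m = 0"
    using * by (subst (asm) sum.reindex[OF inj]) (simp add: sum_divide_distrib)
  then have "(\<Sum>b\<in>B. of_int (u (b / m)) * b) = 0" using assms(1) by simp
  with assms(2) show "\<forall>b\<in>(\<lambda>b. b / m) ` B. u b = 0"
    unfolding int_independent_def by (auto dest!: spec[where x = "\<lambda>b. u (b / m)"])
qed

lemma int_span_superset:
  assumes "finite B" "x \<in> B" shows "x \<in> int_span B"
proof -
  have "x = (\<Sum>b\<in>B. of_int (if b = x then 1 else 0) * b)"
    using assms by (simp add: if_distrib[of of_int] if_distrib[of "\<lambda>t. t * _"] cong: if_cong)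
  then show ?thesis unfolding int_span_def by (intro image_eqI[where x = "\<lambda>b. if b = x then 1 else 0"]) auto
qed

lemma int_span_insert_mono:
  assumes "finite B" "y \<in> int_span B" shows "y \<in> int_span (insert x B)"
proof (cases "x \<in> B")
  case False
  from assms(2) obtain u :: "real \<Rightarrow> int" where u: "y = (\<Sum>b\<in>B. of_int (u b) * b)"
    unfolding int_span_def by auto
  have "y = (\<Sum>b\<in>insert x B. of_int ((u(x:=0)) b) * b)"
    unfolding u using False assms(1) by (auto intro!: sum.cong)
  then show ?thesis unfolding int_span_def by (intro image_eqI[where x = "u(x:=0)"]) auto
qed (use assms in \<open>simp add: insert_absorb\<close>)

lemma int_span_countable:
  assumes "finite B" shows "countable (int_span B)"
proof -
  have "int_span B \<subseteq> (\<lambda>u. \<Sum>b\<in>B. of_int (u b) * b) ` (B \<rightarrow>\<^sub>E (UNIV :: int set))"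
  proof
    fix x assume "x \<in> int_span B"
    then obtain u :: "real \<Rightarrow> int" where u: "x = (\<Sum>b\<in>B. of_int (u b) * b)"
      unfolding int_span_def by auto
    then have "x = (\<Sum>b\<in>B. of_int (restrict u B b) * b)" by simp
    then show "x \<in> (\<lambda>u. \<Sum>b\<in>B. of_int (u b) * b) ` (B \<rightarrow>\<^sub>E (UNIV :: int set))"
      by (intro image_eqI[where x = "restrict u B"]) auto
  qed
  then show ?thesis
    by (rule countable_subset) (intro countable_image countable_PiE assms, auto)
qed

text \<open>
  This replaces a rational basis and the clearing of denominators. By induction on \<open>S\<close>: if
  adjoining \<open>x\<close> destroys independence, then some multiple \<open>m x\<close> with \<open>m \<noteq> 0\<close> is an integer
  combination of \<open>B\<close>, and dividing all of \<open>B\<close> by \<open>m\<close> brings \<open>x\<close> into the span without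
  losing the elements that were already there.
\<close>
lemma int_independent_generators_exist:
  assumes "finite S"
  shows "\<exists>B. finite B \<and> int_independent B \<and> S \<subseteq> int_span B"
  using assms
proof (induction S)
  case empty
  show ?case by (intro exI[of _ "{}"]) (auto simp: int_independent_def)
next
  case (insert x S)
  then obtain B where B: "finite B" "int_independent B" "S \<subseteq> int_span B" by auto
  show ?case
  proof (cases "int_independent (insert x B)")
    case True
    then show ?thesis
      using B int_span_superset[of "insert x B" x] int_span_insert_mono[of B _ x]
      by (intro exI[of _ "insert x B"]) auto
  next
    case False
    with B(2) have xB: "x \<notin> B" by (auto simp: insert_absorb)
    from False obtain u :: "real \<Rightarrow> int" where
      u0: "(\<Sum>b\<in>insert x B. of_int (u b) * b) = 0" and u1: "\<exists>b\<in>insert x B. u b \<noteq> 0"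
      unfolding int_independent_def by auto
    have u2: "of_int (u x) * x + (\<Sum>b\<in>B. of_int (u b) * b) = 0"
      using u0 xB B(1) by simp
    have ux: "u x \<noteq> 0"
      using u2 u1 B(2) unfolding int_independent_def by auto
    define B' where "B' = (\<lambda>b. b / real_of_int (u x)) ` B"
    have inj: "inj_on (\<lambda>b::real. b / of_int (u x)) B"
      using ux by (auto simp: inj_on_def)
    have "(\<Sum>b\<in>B'. of_int (- u (b * of_int (u x))) * b) = (\<Sum>b\<in>B. of_int (- u b) * b) / of_int (u x)"
      unfolding B'_def using ux by (subst sum.reindex[OF inj]) (auto simp: sum_divide_distrib)
    also have "\<dots> = x"
      using u2 ux by (simp add: field_simps sum_negf)
    finally have "x \<in> int_span B'"
      unfolding int_span_def by (intro image_eqI[where x = "\<lambda>b. - u (b * of_int (u x))"]) auto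
    moreover have "S \<subseteq> int_span B'"
      using B int_span_rescale[of "u x" _ B] ux unfolding B'_def by auto
    moreover have "int_independent B'" "finite B'"
      using int_independent_rescale[of "of_int (u x)" B] B ux unfolding B'_def by auto
    ultimately show ?thesis by blast
  qed
qed

text \<open>
  A relation between \<open>B\<close> and \<open>rB\<close> reads \<open>g + r h = 0\<close> with \<open>g\<close>, \<open>h\<close> in the integer span
  of \<open>B\<close>. Unless \<open>h = 0\<close>, it expresses \<open>r\<close> as a quotient of two elements of a countable set;
  and if \<open>h = 0\<close>, then \<open>g = 0\<close> and the independence of \<open>B\<close> kills all coefficients. The disjointness makes \<open>B \<union> rB\<close> twice as large as \<open>B\<close>, so that Kronecker's theorem
  can prescribe the targets on the two parts separately.
\<close>
lemma generic_slope_exists: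
  assumes "finite B" "int_independent B"
  shows "\<exists>r. r \<noteq> 0 \<and> B \<inter> (*) r ` B = {} \<and> int_independent (B \<union> (*) r ` B)"
proof -
  define C where "C = (\<lambda>(g,h). g / h) ` (int_span B \<times> int_span B)"
  have "countable C"
    unfolding C_def using int_span_countable[OF assms(1)] by auto
  then obtain r where r: "r \<notin> C"
    using uncountable_UNIV_real by (metis UNIV_eq_I)
  have nonzero: "u b = 0 \<and> v b = 0"
    if "(\<Sum>b\<in>B. of_int (u b) * b) + r * (\<Sum>b\<in>B. of_int (v b) * b) = 0" "b \<in> B"
    for u v :: "real \<Rightarrow> int" and b
  proof -
    have "(\<Sum>b\<in>B. of_int (- u b) * b) \<in> int_span B" "(\<Sum>b\<in>B. of_int (v b) * b) \<in> int_span B"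
      unfolding int_span_def by (intro image_eqI[where x = "\<lambda>b. - u b"] image_eqI[where x = v]; simp)+
    then have "(\<Sum>b\<in>B. of_int (- u b) * b) / (\<Sum>b\<in>B. of_int (v b) * b) \<in> C"
      unfolding C_def by auto
    with r have "r \<noteq> (\<Sum>b\<in>B. of_int (- u b) * b) / (\<Sum>b\<in>B. of_int (v b) * b)" by auto
    moreover have "r = (\<Sum>b\<in>B. of_int (- u b) * b) / (\<Sum>b\<in>B. of_int (v b) * b)"
      if "(\<Sum>b\<in>B. of_int (v b) * b) \<noteq> 0"
      using \<open>_ + r * _ = 0\<close> by (intro eq_divide_imp[OF that]) (simp add: sum_negf)
    ultimately have "(\<Sum>b\<in>B. of_int (v b) * b) = 0" by blast
    with that assms(2) show ?thesis unfolding int_independent_def by auto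
  qed
  have "0 \<in> C"
    unfolding C_def int_span_def by (auto simp: image_iff intro!: exI[of _ "\<lambda>_. 0"])
  with r have r0: "r \<noteq> 0" by auto
  then have inj: "inj_on ((*) r) B" by (auto simp: inj_on_def)
  have disj: "B \<inter> (*) r ` B = {}"
  proof (rule ccontr)
    assume "B \<inter> (*) r ` B \<noteq> {}"
    then obtain b b' where b: "b \<in> B" "b' \<in> B" "b = r * b'" by auto
    have "(\<Sum>a\<in>B. of_int (if a = b then 1 else 0) * a) + r * (\<Sum>a\<in>B. of_int (if a = b' then - 1 else 0) * a) = 0"
      using b assms(1)
      by (simp add: if_distrib[of of_int] if_distrib[of "\<lambda>t. t * _"] cong: if_cong)
    from nonzero[OF this b(1)] show False by simp
  qed
  have "int_independent (B \<union> (*) r ` B)"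
    unfolding int_independent_def
  proof (intro allI impI)
    fix u :: "real \<Rightarrow> int"
    assume "(\<Sum>b\<in>B \<union> (*) r ` B. of_int (u b) * b) = 0"
    then have "(\<Sum>b\<in>B. of_int (u b) * b) + r * (\<Sum>b\<in>B. of_int (u (r * b)) * b) = 0"
      using assms(1) disj by (simp add: sum.union_disjoint sum.reindex[OF inj] sum_distrib_left mult.left_commute)
    from nonzero[OF this] show "\<forall>b\<in>B \<union> (*) r ` B. u b = 0" by auto
  qed
  with r0 disj show ?thesis by blast
qed

section \<open>Simultaneous approximation in bounded time\<close>

definition near_int :: "real \<Rightarrow> real \<Rightarrow> bool" where
  "near_int \<epsilon> x \<longleftrightarrow> (\<exists>h::int. \<bar>x - of_int h\<bar> < \<epsilon>)"

lemma kronecker_finite_set: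
  assumes "finite A" "int_independent A" "\<epsilon> > 0"
  shows "\<exists>k. \<forall>a\<in>A. near_int \<epsilon> (k * a - \<alpha> a)"
proof -
  interpret Modules.module "(\<lambda>r. (*) (real_of_int r))"
    by (simp add: Modules.module.intro distrib_left mult.commute)
  obtain \<theta> where \<theta>: "bij_betw \<theta> {..<card A} A"
    using ex_bij_betw_nat_finite[OF assms(1)] by (auto simp: atLeast0LessThan)
  have im: "\<theta> ` {..<card A} = A" and inj: "inj_on \<theta> {..<card A}"
    using \<theta> by (auto simp: bij_betw_def)
  have "independent A"
    using assms(2) unfolding dependent_finite[OF assms(1)] int_independent_def by auto
  then have "independent (\<theta> ` {..<card A})" using im by simp
  from Kronecker_thm_1[OF this inj assms(3), of "\<lambda>i. \<alpha> (\<theta> i)"] obtain k h where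
    kh: "\<And>i. i < card A \<Longrightarrow> \<bar>k * \<theta> i - of_int (h i) - \<alpha> (\<theta> i)\<bar> < \<epsilon>" by blast
  have "near_int \<epsilon> (k * a - \<alpha> a)" if "a \<in> A" for a
  proof -
    from that obtain i where "i < card A" "a = \<theta> i" using im by auto
    with kh[of i] show ?thesis unfolding near_int_def by (intro exI[of _ "h i"]) (simp add: algebra_simps)
  qed
  then show ?thesis by blast
qed

text \<open>
  Compactness of the torus of targets: up to \<open>\<epsilon>/2\<close>, only the finitely many targets with
  coordinates in \<open>(1/N)\<int>\<close> modulo 1 occur, and the times needed for these have a common bound.
\<close>
lemma kronecker_bounded_time:
  assumes "finite A" "int_independent A" "\<epsilon> > 0"
  shows "\<exists>L\<ge>0. \<forall>\<alpha>. \<exists>k. \<bar>k\<bar> \<le> L \<and> (\<forall>a\<in>A. near_int \<epsilon> (k * a - \<alpha> a))"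
proof -
  obtain N :: nat where N: "N > 0" "1 / real N < \<epsilon> / 2"
    using real_arch_inverse[of "\<epsilon>/2"] assms(3) by (auto simp: inverse_eq_divide)
  define F where "F = A \<rightarrow>\<^sub>E {0..int N}"
  have F: "finite F" unfolding F_def using assms(1) by (intro finite_PiE) auto
  have "\<forall>j. \<exists>k. \<forall>a\<in>A. near_int (\<epsilon>/2) (k * a - of_int (j a) / real N)" for j :: "real \<Rightarrow> int"
    using kronecker_finite_set[OF assms(1,2), of "\<epsilon>/2"] assms(3) by auto
  then obtain K where K: "\<And>(j :: real \<Rightarrow> int) a. a \<in> A \<Longrightarrow> near_int (\<epsilon>/2) (K j * a - of_int (j a) / real N)"
    by metis
  define L where "L = (\<Sum>j\<in>F. \<bar>K j\<bar>)"
  have "\<exists>k. \<bar>k\<bar> \<le> L \<and> (\<forall>a\<in>A. near_int \<epsilon> (k * a - \<alpha> a))" for \<alpha>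
  proof -
    (* The grid point below \<alpha> modulo 1. *)
    define j where "j = (\<lambda>a\<in>A. \<lfloor>real N * frac (\<alpha> a)\<rfloor>)"
    have "real N * frac y < real N + 1" for y
      using frac_lt_1[of y] mult_left_mono[of "frac y" 1 "real N"] by simp
    then have jF: "j \<in> F"
      unfolding F_def j_def by (auto simp: floor_le_iff)
    have "near_int \<epsilon> (K j * a - \<alpha> a)" if a: "a \<in> A" for a
    proof -
      obtain h :: int where h: "\<bar>K j * a - of_int (j a) / real N - of_int h\<bar> < \<epsilon> / 2"
        using K[OF a, of j] unfolding near_int_def by auto
      have "\<bar>of_int (j a) - real N * frac (\<alpha> a)\<bar> \<le> 1"
        using a unfolding j_def by (simp; linarith)
      then have "\<bar>of_int (j a) - real N * frac (\<alpha> a)\<bar> / real N \<le> 1 / real N"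
        using N(1) by (intro divide_right_mono) auto
      moreover have "\<bar>of_int (j a) - real N * frac (\<alpha> a)\<bar> / real N = \<bar>of_int (j a) / real N - frac (\<alpha> a)\<bar>"
        using N(1) by (simp add: divide_diff_eq_iff mult.commute abs_divide)
      ultimately have "\<bar>of_int (j a) / real N - frac (\<alpha> a)\<bar> < \<epsilon> / 2" using N(2) by linarith
      with h have "\<bar>(K j * a - \<alpha> a) - of_int (h - \<lfloor>\<alpha> a\<rfloor>)\<bar> < \<epsilon>"
        unfolding frac_def of_int_diff by linarith
      then show ?thesis unfolding near_int_def by blast
    qed
    moreover have "\<bar>K j\<bar> \<le> L"
      unfolding L_def using member_le_sum[OF jF, of "\<lambda>j. \<bar>K j\<bar>"] F by auto
    ultimately show ?thesis by blast
  qed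
  moreover have "L \<ge> 0" unfolding L_def by (auto intro: sum_nonneg)
  ultimately show ?thesis by blast
qed

section \<open>Points close to the lattice on lines and circles\<close>

lemma near_int_add:
  assumes "near_int \<epsilon> x" "\<bar>y - x\<bar> \<le> \<delta>"
  shows "near_int (\<epsilon> + \<delta>) y"
proof -
  obtain h :: int where "\<bar>x - of_int h\<bar> < \<epsilon>" using assms(1) unfolding near_int_def by blast
  with assms(2) show ?thesis unfolding near_int_def by (intro exI[of _ h]) linarith
qed

text \<open>
  Passing from generators to their integer combinations multiplies the error by the sum of the
  absolute values of the coefficients.
\<close>
lemma near_int_combination:
  assumes "\<And>b. b \<in> B \<Longrightarrow> near_int \<delta> (c * b)"
    "x = (\<Sum>b\<in>B. of_int (u b) * b)" "(\<Sum>b\<in>B. \<bar>real_of_int (u b)\<bar>) * \<delta> < \<epsilon>"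
  shows "near_int \<epsilon> (c * x)"
proof -
  obtain h :: "real \<Rightarrow> int" where h: "\<And>b. b \<in> B \<Longrightarrow> \<bar>c * b - of_int (h b)\<bar> < \<delta>"
    using assms(1) unfolding near_int_def by metis
  have "c * x - of_int (\<Sum>b\<in>B. u b * h b) = (\<Sum>b\<in>B. of_int (u b) * (c * b - of_int (h b)))"
    unfolding assms(2) by (simp add: sum_distrib_left sum_subtractf algebra_simps)
  also have "\<bar>\<dots>\<bar> \<le> (\<Sum>b\<in>B. \<bar>real_of_int (u b)\<bar> * \<delta>)"
    by (intro order.trans[OF sum_abs] sum_mono)
       (auto simp: abs_mult intro!: mult_left_mono less_imp_le[OF h])
  also have "\<dots> < \<epsilon>" using assms(3) by (simp add: sum_distrib_right)
  finally show ?thesis unfolding near_int_def by blast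
qed

text \<open>
  With \<open>w = 1 + ir\<close> for a generic slope \<open>r\<close>, the numbers \<open>b Re (z + k w)\<close> and \<open>b Im (z + k w)\<close>
  for \<open>b \<in> B\<close> move with the independent velocities \<open>b\<close> and \<open>r b\<close>. Hence \<open>w\<close> and \<open>L\<close> can be
  chosen before \<open>z\<close>: the starting point only changes the target in Kronecker's theorem.
\<close>
lemma line_meets_near_lattice:
  assumes "finite S" "\<epsilon> > 0"
  shows "\<exists>w L. w \<noteq> 0 \<and> L \<ge> 0 \<and> (\<forall>z. \<exists>k. \<bar>k\<bar> \<le> L \<and>
    (\<forall>x\<in>S. near_int \<epsilon> (Re (z + of_real k * w) * x) \<and> near_int \<epsilon> (Im (z + of_real k * w) * x)))"
proof -
  obtain B where B: "finite B" "int_independent B" "S \<subseteq> int_span B"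
    using int_independent_generators_exist[OF assms(1)] by auto
  obtain U :: "real \<Rightarrow> real \<Rightarrow> int" where U: "\<And>x. x \<in> S \<Longrightarrow> x = (\<Sum>b\<in>B. of_int (U x b) * b)"
    using B(3) unfolding int_span_def by (simp add: subset_iff image_iff) metis
  define M where "M = (\<Sum>x\<in>S. \<Sum>b\<in>B. \<bar>real_of_int (U x b)\<bar>)"
  define \<delta> where "\<delta> = \<epsilon> / (M + 1)"
  have M0: "M \<ge> 0" unfolding M_def by (auto intro!: sum_nonneg)
  then have \<delta>: "\<delta> > 0" "M * \<delta> < \<epsilon>"
    using assms(2) unfolding \<delta>_def by (auto simp: field_simps)
  have MU: "(\<Sum>b\<in>B. \<bar>real_of_int (U x b)\<bar>) * \<delta> < \<epsilon>" if "x \<in> S" for x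
  proof -
    have "(\<Sum>b\<in>B. \<bar>real_of_int (U x b)\<bar>) \<le> M"
      unfolding M_def using that assms(1)
      by (intro member_le_sum[where f = "\<lambda>x. \<Sum>b\<in>B. \<bar>real_of_int (U x b)\<bar>"]) (auto intro: sum_nonneg)
    then show ?thesis using \<delta> by (meson less_le_trans mult_right_mono less_imp_le le_less_trans)
  qed
  obtain r where r: "r \<noteq> 0" "B \<inter> (*) r ` B = {}" "int_independent (B \<union> (*) r ` B)"
    using generic_slope_exists[OF B(1,2)] by auto
  obtain L where L: "L \<ge> 0" "\<And>\<alpha>. \<exists>k. \<bar>k\<bar> \<le> L \<and> (\<forall>a\<in>B \<union> (*) r ` B. near_int \<delta> (k * a - \<alpha> a))"
    using kronecker_bounded_time[OF _ r(3) \<delta>(1)] B(1) by auto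
  have "\<exists>k. \<bar>k\<bar> \<le> L \<and> (\<forall>x\<in>S. near_int \<epsilon> (Re (z + of_real k * Complex 1 r) * x)
      \<and> near_int \<epsilon> (Im (z + of_real k * Complex 1 r) * x))" for z
  proof -
    (* The motion has to cancel the values b * Re z and b * Im z at the starting point; on r * B
       the argument a of the target is r * b, whence the division. *)
    obtain k where k: "\<bar>k\<bar> \<le> L" "\<And>a. a \<in> B \<union> (*) r ` B \<Longrightarrow>
        near_int \<delta> (k * a - (if a \<in> B then - Re z * a else - Im z * (a / r)))"
      using L(2)[of "\<lambda>a. if a \<in> B then - Re z * a else - Im z * (a / r)"] by blast
    have re: "near_int \<delta> (Re (z + of_real k * Complex 1 r) * b)" if "b \<in> B" for b
      using k(2)[of b] that by (simp add: algebra_simps)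
    have im: "near_int \<delta> (Im (z + of_real k * Complex 1 r) * b)" if "b \<in> B" for b
    proof -
      have "r * b \<notin> B" using that r(2) by auto
      then show ?thesis using k(2)[of "r * b"] that r(1) by (simp add: algebra_simps)
    qed
    from k(1) near_int_combination[OF re U MU] near_int_combination[OF im U MU]
    show ?thesis by blast
  qed
  moreover have "Complex 1 r \<noteq> 0" by (simp add: complex_eq_iff)
  ultimately show ?thesis using L(1) by blast
qed

text \<open>
  The segment of direction \<open>w\<close> through \<open>z0 = it w/\<bar>w\<bar>\<close> is tangent to the circle of radius
  \<open>t\<close>. By Pythagoras its points have modulus \<open>sqrt (t\<^sup>2 + k\<^sup>2\<bar>w\<bar>\<^sup>2)\<close>, so projecting a good point
  \<open>z'\<close> of it radially onto the circle moves it by at most \<open>L\<^sup>2\<bar>w\<bar>\<^sup>2/t\<close>, which tends to 0.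
\<close>
lemma circle_meets_near_lattice:
  assumes "finite S" "\<epsilon> > 0"
  shows "\<exists>T. \<forall>t\<ge>T. \<exists>z. cmod z = t \<and> (\<forall>x\<in>S. near_int \<epsilon> (Re z * x) \<and> near_int \<epsilon> (Im z * x))"
proof -
  obtain w L where w: "w \<noteq> 0" and L: "L \<ge> 0" and k: "\<And>z. \<exists>k. \<bar>k\<bar> \<le> L \<and>
    (\<forall>x\<in>S. near_int (\<epsilon>/2) (Re (z + of_real k * w) * x) \<and> near_int (\<epsilon>/2) (Im (z + of_real k * w) * x))"
    using line_meets_near_lattice[OF assms(1), of "\<epsilon>/2"] assms(2) by auto
  define D where "D = (L * cmod w)\<^sup>2"
  define P where "P = (\<Sum>x\<in>S. \<bar>x\<bar>)"
  have D0: "D \<ge> 0" and P0: "P \<ge> 0" unfolding D_def P_def by (auto intro: sum_nonneg)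
  (* From this radius on, the radial displacement D / t times any x in S is at most \<epsilon> / 2. *)
  show ?thesis
  proof (intro exI[of _ "max 1 (2 * D * P / \<epsilon>)"] allI impI)
    fix t assume "max 1 (2 * D * P / \<epsilon>) \<le> t"
    then have t: "t \<ge> 1" "D * P \<le> t * (\<epsilon> / 2)" using assms(2) by (auto simp: field_simps)
    define z0 where "z0 = of_real t * (\<i> * sgn w)"
    obtain k where k: "\<bar>k\<bar> \<le> L" "\<And>x. x \<in> S \<Longrightarrow> near_int (\<epsilon>/2) (Re (z0 + of_real k * w) * x) \<and> near_int (\<epsilon>/2) (Im (z0 + of_real k * w) * x)"
      using k[of z0] by auto
    define z' where "z' = z0 + of_real k * w"
    have "of_real (cmod w) * sgn w = w"
      using w by (simp add: sgn_eq)
    then have "of_real k * w = of_real k * (of_real (cmod w) * sgn w)" by simp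
    then have "z' = (of_real (k * cmod w) + \<i> * of_real t) * sgn w"
      unfolding z'_def z0_def by (simp add: algebra_simps)
    then have "cmod z' = cmod (Complex (k * cmod w) t)"
      using w by (simp add: norm_mult norm_sgn complex_eq Complex_eq)
    then have nz: "(cmod z')\<^sup>2 = t\<^sup>2 + (k * cmod w)\<^sup>2"
      by (simp add: cmod_power2)
    have kD: "(k * cmod w)\<^sup>2 \<le> D"
      unfolding D_def by (rule power2_le_iff_abs_le[THEN iffD2]) (use k(1) L in \<open>auto simp: abs_mult intro: mult_right_mono\<close>)
    have "t\<^sup>2 \<le> (cmod z')\<^sup>2" unfolding nz by simp
    then have ge: "cmod z' \<ge> t" by (rule power2_le_imp_le) simp
    have "(cmod z' - t) * t \<le> (cmod z' - t) * (cmod z' + t)"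
      using ge t(1) by (intro mult_left_mono) auto
    also have "\<dots> \<le> D" using nz kD by (simp add: power2_eq_square algebra_simps)
    finally have diff: "(cmod z' - t) * t \<le> D" .
    define z where "z = of_real t * sgn z'"
    have z'0: "z' \<noteq> 0" using ge t(1) by auto
    have "z - z' = of_real (t - cmod z') * sgn z'"
      using z'0 unfolding z_def by (simp add: sgn_eq algebra_simps)
    then have zz: "cmod (z - z') = cmod z' - t"
      using z'0 ge by (simp add: norm_mult norm_sgn flip: of_real_diff)
    have small: "\<bar>c * x\<bar> \<le> \<epsilon> / 2" if "x \<in> S" "\<bar>c\<bar> \<le> cmod (z - z')" for c x
    proof -
      have "\<bar>x\<bar> \<le> P" unfolding P_def using that(1) assms(1) by (intro member_le_sum) auto
      then have "\<bar>c * x\<bar> \<le> (cmod z' - t) * P"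
        using that(2) ge unfolding zz abs_mult by (intro mult_mono) auto
      then have "\<bar>c * x\<bar> * t \<le> (cmod z' - t) * t * P"
        using t(1) mult_right_mono[of "\<bar>c * x\<bar>" "(cmod z' - t) * P" t] by (simp add: mult_ac)
      also have "\<dots> \<le> D * P" using diff P0 by (intro mult_right_mono)
      finally have "\<bar>c * x\<bar> * t \<le> (\<epsilon> / 2) * t" using t(2) by (simp add: mult.commute)
      then show ?thesis using t(1) by (simp only: mult_le_cancel_right)
    qed
    have "near_int \<epsilon> (Re z * x) \<and> near_int \<epsilon> (Im z * x)" if "x \<in> S" for x
    proof -
      have "\<bar>Re z * x - Re z' * x\<bar> \<le> \<epsilon> / 2" "\<bar>Im z * x - Im z' * x\<bar> \<le> \<epsilon> / 2"
        using small[OF that, of "Re (z - z')"] small[OF that, of "Im (z - z')"]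
          abs_Re_le_cmod[of "z - z'"] abs_Im_le_cmod[of "z - z'"] by (simp_all add: left_diff_distrib)
      then show ?thesis
        using k(2)[OF that, folded z'_def] near_int_add[of "\<epsilon>/2" _ _ "\<epsilon>/2"] by fastforce
    qed
    moreover have "cmod z = t" using z'0 t(1) unfolding z_def by (simp add: norm_mult norm_sgn)
    ultimately show "\<exists>z. cmod z = t \<and> (\<forall>x\<in>S. near_int \<epsilon> (Re z * x) \<and> near_int \<epsilon> (Im z * x))"
      by blast
  qed
qed

section \<open>Rotating and stretching the embedding\<close>

text \<open>Complex multiplication, transported to \<open>real ^ 2\<close>: a rotation followed by a stretch by \<open>cmod z\<close>.\<close>
definition cmult_vec :: "complex \<Rightarrow> real ^ 2 \<Rightarrow> real ^ 2" where
  "cmult_vec z p = vector [Re z * p $ 1 - Im z * p $ 2, Im z * p $ 1 + Re z * p $ 2]"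

lemma dist_cmult_vec: "dist (cmult_vec z p) (cmult_vec z q) = cmod z * dist p q"
proof -
  have "(dist (cmult_vec z p) (cmult_vec z q))\<^sup>2 = (cmod z * dist p q)\<^sup>2"
    unfolding cmult_vec_def dist_norm power_mult_distrib cmod_power2 power2_norm_eq_inner
    by (simp add: inner_vec_def sum_2 power2_eq_square algebra_simps)
  then show ?thesis by (subst (asm) power2_eq_iff_nonneg) auto
qed

lemma norm_Z_le:
  assumes "\<And>i. near_int \<epsilon> (p $ i)"
  shows "norm_Z p \<le> 2 * \<epsilon>"
proof -
  obtain h :: "2 \<Rightarrow> int" where h: "\<And>i. \<bar>p $ i - of_int (h i)\<bar> < \<epsilon>"
    using assms unfolding near_int_def by metis
  have "norm_Z p \<le> dist p (\<chi> i. of_int (h i))"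
    unfolding norm_Z_def int_lattice_def by (intro infdist_le) auto
  also have "\<dots> \<le> (\<Sum>i\<in>UNIV. \<bar>p $ i - of_int (h i)\<bar>)"
    unfolding dist_norm by (rule order.trans[OF norm_le_l1_cart]) simp
  also have "\<dots> \<le> 2 * \<epsilon>" using h[of 1] h[of 2] by (simp add: sum_2)
  finally show ?thesis .
qed

lemma norm_Z_cmult_vec_le:
  assumes "\<And>i. near_int \<epsilon> (Re z * p $ i)" "\<And>i. near_int \<epsilon> (Im z * p $ i)"
  shows "norm_Z (cmult_vec z p) \<le> 4 * \<epsilon>"
proof -
  obtain g h :: "2 \<Rightarrow> int" where gh: "\<And>i. \<bar>Re z * p $ i - of_int (g i)\<bar> < \<epsilon>" "\<And>i. \<bar>Im z * p $ i - of_int (h i)\<bar> < \<epsilon>"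
    using assms unfolding near_int_def by metis
  have "near_int (2 * \<epsilon>) (cmult_vec z p $ i)" for i
  proof (cases "i = 1")
    case True
    have "\<bar>cmult_vec z p $ i - of_int (g 1 - h 2)\<bar> < 2 * \<epsilon>"
      using gh(1)[of 1] gh(2)[of 2] unfolding True cmult_vec_def by (simp; linarith)
    then show ?thesis unfolding near_int_def by blast
  next
    case False
    then have i: "i = 2" using exhaust_2 by blast
    have "\<bar>cmult_vec z p $ i - of_int (h 1 + g 2)\<bar> < 2 * \<epsilon>"
      using gh(1)[of 2] gh(2)[of 1] unfolding i cmult_vec_def by (simp; linarith)
    then show ?thesis unfolding near_int_def by blast
  qed
  from norm_Z_le[OF this] show ?thesis by simp
qed

lemma tau2_scale_le:
  assumes "f \<in> Sigma2 X d" "cmod z = t"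
    "\<And>x i. x \<in> X \<Longrightarrow> near_int \<epsilon> (Re z * f x $ i) \<and> near_int \<epsilon> (Im z * f x $ i)"
  shows "tau2 X (scale_dist t d) \<le> ennreal (4 * \<epsilon>)"
proof -
  define g where "g = (\<lambda>x\<in>X. cmult_vec z (f x))"
  have "g \<in> Sigma2 X (scale_dist t d)"
    using assms(1,2) unfolding Sigma2_def g_def scale_dist_def by (auto simp: dist_cmult_vec)
  then have "tau2 X (scale_dist t d) \<le> (SUP x\<in>X. ennreal (norm_Z (g x)))"
    unfolding tau2_def by (rule INF_lower)
  also have "\<dots> \<le> ennreal (4 * \<epsilon>)"
    using assms(3) unfolding g_def by (intro SUP_least ennreal_leI) (auto intro!: norm_Z_cmult_vec_le)
  finally show ?thesis .
qed

theorem theorem1p3: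
  fixes X :: "'a set" and d :: "'a \<Rightarrow> 'a \<Rightarrow> real"
  assumes "Metric_space X d" and "finite X" and "two_flat X d"
  shows "((\<lambda>t. tau2 X (scale_dist t d)) \<longlongrightarrow> 0) at_top"
proof -
  obtain f where f: "f \<in> Sigma2 X d" using assms(3) unfolding two_flat_def by auto
  define S where "S = (\<lambda>(x, i). f x $ i) ` (X \<times> UNIV)"
  have S: "finite S" "\<And>x i. x \<in> X \<Longrightarrow> f x $ i \<in> S" unfolding S_def using assms(2) by auto
  show ?thesis
  proof (rule order_tendstoI)
    fix a :: ennreal assume "0 < a"
    then obtain e where e: "0 < e" "e < a" using dense by blast
    then have "e < top" using less_trans[of e a] by (metis less_le_trans top_greatest)
    with e obtain r where r: "r > 0" "e = ennreal r"
      by (cases e) auto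
    obtain T where T: "\<And>t. t \<ge> T \<Longrightarrow> \<exists>z. cmod z = t \<and>
        (\<forall>x\<in>S. near_int (r/4) (Re z * x) \<and> near_int (r/4) (Im z * x))"
      using circle_meets_near_lattice[OF S(1), of "r/4"] r(1) by auto
    have "tau2 X (scale_dist t d) < a" if t: "t \<ge> T" for t
    proof -
      obtain z where z: "cmod z = t" "\<And>x. x \<in> S \<Longrightarrow> near_int (r/4) (Re z * x) \<and> near_int (r/4) (Im z * x)"
        using T[OF t] by blast
      have "tau2 X (scale_dist t d) \<le> ennreal (4 * (r/4))"
        using S(2) z(2) by (intro tau2_scale_le[OF f z(1)]) auto
      with e(2) r(2) show ?thesis by simp
    qed
    then show "eventually (\<lambda>t. tau2 X (scale_dist t d) < a) at_top"
      by (auto simp: eventually_at_top_linorder)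
  qed auto
qed

end
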